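(* For every $d\ge3$ there exists a sphere packing of $\mathbb{R}^d$ such that simple random walk with unit conductances on its tangency graph does not converge to Brownian motion modulo time parametrization in the scaling limit. Moreover, the packing can be chosen so that all spheres have radius either $1$ or $1/2$ and each sphere is tangent to a bounded number of other spheres (with a uniform bound).
   Context: A sphere packing is a collection of $d$-dimensional spheres in $\mathbb{R}^d$ with disjoint interiors (radii may vary). Its tangency graph has one vertex per sphere, located at the center of the sphere, and an edge between two vertices when the corresponding spheres are tangent. Simple random walk with unit conductances jumps from a vertex to a uniformly chosen neighbor. Convergence in the scaling limit to Brownian motion modulo time parametrization means: for every bounded Lipschitz domain $U\subset\mathbb{R}^d$ and $z\in U$, as $\epsilon\to0$, the linearly interpolated walk on the packing rescaled by $\epsilon$, started at the rescaled vertex nearest to $z$ and stopped upon exiting $U$, converges in law to standard $d$-dimensional Brownian motion started at $z$ and stopped upon exiting $U$, with respect to the metric $d(\phi_1,\phi_2)=\inf_\psi\sup_{t\in[0,T_1]}|\phi_1(t)-\phi_2(\psi(t))|$ on continuous curves $\phi_i:[0,T_i]\to\mathbb{R}^d$, where the infimum is over increasing homeomorphisms $\psi:[0,T_1]\to[0,T_2]$. The theorem asserts that this fails. *)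

theory Defs
  imports "HOL-Probability.Probability"
begin
text \<open>
  A packing is given by its set \<open>V\<close> of centers and the radius \<open>r v\<close> of the sphere centered
  at \<open>v\<close>. Nothing is lost: spheres with disjoint interiors have distinct centers.
\<close>

definition sphere_packing :: "'a::euclidean_space set \<Rightarrow> ('a \<Rightarrow> real) \<Rightarrow> bool" where
  "sphere_packing V r \<longleftrightarrow>
     (\<forall>v\<in>V. 0 < r v) \<and> disjoint_family_on (\<lambda>v. ball v (r v)) V"

text \<open>Only external tangency can occur between spheres with disjoint interiors.\<close>

definition tangent :: "'a::euclidean_space set \<Rightarrow> ('a \<Rightarrow> real) \<Rightarrow> 'a \<Rightarrow> 'a \<Rightarrow> bool" where
  "tangent V r u v \<longleftrightarrow> u \<in> V \<and> v \<in> V \<and> u \<noteq> v \<and> dist u v = r u + r v"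

definition neighbors :: "'a::euclidean_space set \<Rightarrow> ('a \<Rightarrow> real) \<Rightarrow> 'a \<Rightarrow> 'a set" where
  "neighbors V r v = {u. tangent V r v u}"

text \<open>
  Connectedness and relative density say that the packing is one of the whole space: otherwise a
  finite packing, say, would trivially have no Brownian scaling limit. With relative density the
  rescaled vertex nearest to a point \<open>z\<close> converges to \<open>z\<close>, and both together give every
  vertex a neighbor.
\<close>

definition tangency_connected :: "'a::euclidean_space set \<Rightarrow> ('a \<Rightarrow> real) \<Rightarrow> bool" where
  "tangency_connected V r \<longleftrightarrow> (\<forall>u\<in>V. \<forall>v\<in>V. (tangent V r)\<^sup>*\<^sup>* u v)"

definition relatively_dense :: "'a::metric_space set \<Rightarrow> bool" where
  "relatively_dense V \<longleftrightarrow> (\<exists>R. \<forall>z. \<exists>v\<in>V. dist z v \<le> R)"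

text \<open>
  \<open>srw_kernel V r x i \<omega>\<close> is the conditional law of the position at time \<open>i\<close> given the positions
  \<open>\<omega> 0, \<dots>, \<omega> (i - 1)\<close>. The uniform distribution on the neighbors is meaningful at vertices
  of finite nonzero degree only; no convention is attached to other vertices.
\<close>

definition srw_kernel ::
  "'a::euclidean_space set \<Rightarrow> ('a \<Rightarrow> real) \<Rightarrow> 'a \<Rightarrow> nat \<Rightarrow> (nat \<Rightarrow> 'a) \<Rightarrow> 'a measure" where
  "srw_kernel V r x i \<omega> =
     measure_pmf (if i = 0 then return_pmf x else pmf_of_set (neighbors V r (\<omega> (i - 1))))"

lemma Ionescu_Tulcea_srw_kernel:
  "Ionescu_Tulcea (srw_kernel V r x) (\<lambda>_. count_space UNIV)"
proof (rule Ionescu_Tulcea.intro)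
  fix i
  show "srw_kernel V r x i
      \<in> PiM {0..<i} (\<lambda>_. count_space UNIV) \<rightarrow>\<^sub>M subprob_algebra (count_space UNIV)"
  proof (cases "i = 0")
    case True
    then show ?thesis
      by (simp add: srw_kernel_def[abs_def] measure_pmf_in_subprob_algebra)
  next
    case False
    have "(\<lambda>\<omega>. \<omega> (i - 1)) \<in> PiM {0..<i} (\<lambda>_. count_space UNIV) \<rightarrow>\<^sub>M count_space UNIV"
      using False by (intro measurable_component_singleton) auto
    moreover have "(\<lambda>y. measure_pmf (pmf_of_set (neighbors V r y)))
        \<in> count_space UNIV \<rightarrow>\<^sub>M subprob_algebra (count_space UNIV)"
      by (simp add: measure_pmf_in_subprob_algebra)
    ultimately have "(\<lambda>\<omega>. measure_pmf (pmf_of_set (neighbors V r (\<omega> (i - 1)))))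
        \<in> PiM {0..<i} (\<lambda>_. count_space UNIV) \<rightarrow>\<^sub>M subprob_algebra (count_space UNIV)"
      by (rule measurable_compose)
    then show ?thesis
      using False by (simp add: srw_kernel_def[abs_def])
  qed
next
  fix i x'
  show "prob_space (srw_kernel V r x i x')"
    by (simp add: srw_kernel_def measure_pmf.prob_space_axioms)
qed

interpretation srw: Ionescu_Tulcea "srw_kernel V r x" "\<lambda>_. count_space UNIV" for V r x
  by (rule Ionescu_Tulcea_srw_kernel)

abbreviation srw_law ::
  "'a::euclidean_space set \<Rightarrow> ('a \<Rightarrow> real) \<Rightarrow> 'a \<Rightarrow> (nat \<Rightarrow> 'a) measure" where
  "srw_law V r x \<equiv> srw.PF.lim V r x"

definition interpolate :: "(nat \<Rightarrow> 'a::real_vector) \<Rightarrow> real \<Rightarrow> 'a" where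
  "interpolate X t =
     (1 - frac t) *\<^sub>R X (nat \<lfloor>t\<rfloor>) + frac t *\<^sub>R X (Suc (nat \<lfloor>t\<rfloor>))"

text \<open>
  The vertex of \<open>V\<close> whose image under scaling by \<open>\<epsilon>\<close> is nearest to \<open>z\<close>; ties are broken
  arbitrarily.
\<close>

definition nearest_vertex :: "'a::euclidean_space set \<Rightarrow> real \<Rightarrow> 'a \<Rightarrow> 'a" where
  "nearest_vertex V \<epsilon> z = closest_point ((\<lambda>v. \<epsilon> *\<^sub>R v) ` V) z /\<^sub>R \<epsilon>"

text \<open>
  A pair \<open>(T, \<phi>)\<close> stands for the restriction of \<open>\<phi>\<close> to \<open>{0..T}\<close>. The distance is
  \<open>\<infinity>\<close> if there is no increasing homeomorphism, which happens when exactly one of the two time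
  intervals is a point.
\<close>

type_synonym 'a curve = "real \<times> (real \<Rightarrow> 'a)"

definition curves :: "'a::euclidean_space curve set" where
  "curves = {(T, \<phi>). 0 \<le> T \<and> continuous_on {0..T} \<phi>}"

definition increasing_homeomorphisms :: "real \<Rightarrow> real \<Rightarrow> (real \<Rightarrow> real) set" where
  "increasing_homeomorphisms T\<^sub>1 T\<^sub>2 =
     {\<psi>. strict_mono_on {0..T\<^sub>1} \<psi> \<and> (\<exists>\<psi>'. homeomorphism {0..T\<^sub>1} {0..T\<^sub>2} \<psi> \<psi>')}"

definition curve_dist :: "'a::euclidean_space curve \<Rightarrow> 'a curve \<Rightarrow> ennreal" where
  "curve_dist \<gamma>\<^sub>1 \<gamma>\<^sub>2 =
     (INF \<psi>\<in>increasing_homeomorphisms (fst \<gamma>\<^sub>1) (fst \<gamma>\<^sub>2).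
        SUP t\<in>{0..fst \<gamma>\<^sub>1}. ennreal (dist (snd \<gamma>\<^sub>1 t) (snd \<gamma>\<^sub>2 (\<psi> t))))"

definition curve_continuous :: "('a::euclidean_space curve \<Rightarrow> real) \<Rightarrow> bool" where
  "curve_continuous F \<longleftrightarrow>
     (\<forall>\<gamma>\<in>curves. \<forall>e>0. \<exists>\<delta>>0. \<forall>\<gamma>'\<in>curves.
        curve_dist \<gamma> \<gamma>' < ennreal \<delta> \<longrightarrow> \<bar>F \<gamma>' - F \<gamma>\<bar> < e)"

text \<open>Every continuous \<open>F\<close> identifies curves at distance \<open>0\<close>, so no quotient is needed.\<close>

definition converges_in_law ::
  "('i \<Rightarrow> 'w measure) \<Rightarrow> ('i \<Rightarrow> 'w \<Rightarrow> 'a::euclidean_space curve) \<Rightarrow>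
   'v measure \<Rightarrow> ('v \<Rightarrow> 'a curve) \<Rightarrow> 'i filter \<Rightarrow> bool" where
  "converges_in_law M Y N Y\<^sub>0 G \<longleftrightarrow>
     (\<forall>F. curve_continuous F \<and> bounded (F ` curves) \<longrightarrow>
        ((\<lambda>i. \<integral>\<omega>. F (Y i \<omega>) \<partial>M i) \<longlongrightarrow> (\<integral>\<omega>. F (Y\<^sub>0 \<omega>) \<partial>N)) G)"

text \<open>
  Curves that never leave \<open>U\<close> are given the exit time \<open>0\<close>. For bounded \<open>U\<close> this is
  immaterial for Brownian motion, which leaves \<open>U\<close> almost surely, and likewise for the walk on a
  connected, infinite, locally finite tangency graph with finitely many vertices in each bounded set.
\<close>

definition exit_time :: "'a set \<Rightarrow> (real \<Rightarrow> 'a) \<Rightarrow> real" where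
  "exit_time U \<gamma> = (if \<exists>t\<ge>0. \<gamma> t \<notin> U then Inf {t. 0 \<le> t \<and> \<gamma> t \<notin> U} else 0)"

definition stopped :: "'a set \<Rightarrow> (real \<Rightarrow> 'a) \<Rightarrow> 'a curve" where
  "stopped U \<gamma> = (exit_time U \<gamma>, \<gamma>)"

definition brownian_motion ::
  "'w measure \<Rightarrow> (real \<Rightarrow> 'w \<Rightarrow> 'a::euclidean_space) \<Rightarrow> 'a \<Rightarrow> bool" where
  "brownian_motion M B z \<longleftrightarrow>
     prob_space M \<and>
     (\<forall>t\<ge>0. B t \<in> borel_measurable M) \<and>
     (\<forall>\<omega>\<in>space M. continuous_on {0..} (\<lambda>t. B t \<omega>)) \<and>
     (AE \<omega> in M. B 0 \<omega> = z) \<and>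
     (\<forall>s t. 0 \<le> s \<and> s < t \<longrightarrow>
        distributed M lborel (\<lambda>\<omega>. B t \<omega> - B s \<omega>)
          (\<lambda>x. \<Prod>b\<in>Basis. ennreal (normal_density 0 (sqrt (t - s)) (x \<bullet> b)))) \<and>
     (\<forall>\<tau>::nat \<Rightarrow> real. 0 \<le> \<tau> 0 \<and> mono \<tau> \<longrightarrow>
        prob_space.indep_vars M (\<lambda>_. borel) (\<lambda>i \<omega>. B (\<tau> (Suc i)) \<omega> - B (\<tau> i) \<omega>) UNIV)"

text \<open>
  Near each boundary point, in suitable orthogonal coordinates \<open>(y, s)\<close> with
  \<open>x = y + s e\<close>, the domain is the region above the graph of a Lipschitz function.
\<close>

definition bounded_lipschitz_domain :: "'a::euclidean_space set \<Rightarrow> bool" where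
  "bounded_lipschitz_domain U \<longleftrightarrow>
     open U \<and> connected U \<and> bounded U \<and>
     (\<forall>p\<in>frontier U. \<exists>\<rho>>0. \<exists>e g L. norm e = 1 \<and> L-lipschitz_on {y. y \<bullet> e = 0} g \<and>
        U \<inter> ball p \<rho> = {x \<in> ball p \<rho>. g (x - (x \<bullet> e) *\<^sub>R e) < x \<bullet> e})"

text \<open>
  The probability space carrying the Brownian motion is left arbitrary, on the type of paths.
  Every Brownian motion can be realized there as the coordinate process, and its law is determined
  by \<open>z\<close>, so the choice does not affect the notion.
\<close>

definition srw_converges_to_brownian_motion ::
  "'a::euclidean_space set \<Rightarrow> ('a \<Rightarrow> real) \<Rightarrow> bool" where
  "srw_converges_to_brownian_motion V r \<longleftrightarrow>
     (\<forall>U z. bounded_lipschitz_domain U \<and> z \<in> U \<longrightarrow>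
        (\<exists>(M :: (real \<Rightarrow> 'a) measure) B. brownian_motion M B z \<and>
           converges_in_law
             (\<lambda>\<epsilon>. srw_law V r (nearest_vertex V \<epsilon> z))
             (\<lambda>\<epsilon> X. stopped U (interpolate (\<lambda>n. \<epsilon> *\<^sub>R X n)))
             M (\<lambda>\<omega>. stopped U (\<lambda>t. B t \<omega>))
             (at_right 0)))"

end

theory Submission
  imports Defs
begin

text \<open>
  The packing is a comb of unit spheres: teeth parallel to a coordinate direction \<open>a\<close>, too far
  apart to touch each other and joined only along the hyperplane orthogonal to \<open>a\<close> through the
  origin. Started at distance 2 from that hyperplane and stopped on leaving a unit ball, the rescaled
  walk never leaves its tooth, so its limit stays on a line. Brownian motion does not: at each positive
  time it is almost surely off the line, although it has a chance to leave the ball.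
\<close>

section \<open>Lipschitz functionals of stopped curves\<close>

text \<open>One domain, one starting point and one test functional witness the failure. The
  functional must be continuous for a metric that allows reparametrization, so evaluation at a fixed
  time is excluded; the infimum of a function \<open>h\<close> along a curve depends only on the
  range of the curve and inherits a Lipschitz bound from \<open>h\<close>. Here \<open>h\<close> is
  a tent of height 1 in a coordinate \<open>b\<close> transverse to the teeth. This coordinate of
  the walk is frozen until the exit, so the functional equals its value at the starting vertex and
  tends to 1 as that vertex approaches a point with \<open>b\<close>-coordinate 0. For Brownian
  motion, an integral equal to 1 would force the \<open>b\<close>-coordinate to vanish almost surely
  up to the exit. The ball does not shrink with \<epsilon>, while scaling preserves the joining
  hyperplane, so one ball serves all scales. Spacing 4 between teeth is twice the tangency distance
  of unit spheres, and 2 is the room needed for the spheres that join the teeth inside the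
  hyperplane.\<close>

definition path_inf :: "('a::euclidean_space \<Rightarrow> real) \<Rightarrow> 'a curve \<Rightarrow> real" where
  "path_inf h \<gamma> = (INF t\<in>{0..fst \<gamma>}. h (snd \<gamma> t))"

lemma path_inf_le:
  assumes "\<And>x. 0 \<le> h x" "t \<in> {0..fst \<gamma>}"
  shows "path_inf h \<gamma> \<le> h (snd \<gamma> t)"
  unfolding path_inf_def by (rule cINF_lower[OF _ assms(2)]) (use assms(1) in \<open>auto intro!: bdd_belowI\<close>)

lemma le_path_inf:
  assumes "0 \<le> fst \<gamma>" "\<And>t. t \<in> {0..fst \<gamma>} \<Longrightarrow> y \<le> h (snd \<gamma> t)"
  shows "y \<le> path_inf h \<gamma>"
  unfolding path_inf_def by (rule cINF_greatest) (use assms in auto)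

text \<open>An almost optimal reparametrization pairs every point of either curve with a nearby
  point of the other, because \<open>\<psi>\<close> is onto. The two infima then differ by at most
  the uniform distance, so \<open>\<delta> = e\<close> works.\<close>

lemma curve_continuous_path_inf:
  assumes nonneg: "\<And>x. 0 \<le> h x" and lip: "\<And>x y. \<bar>h x - h y\<bar> \<le> dist x y"
  shows "curve_continuous (path_inf h)"
  unfolding curve_continuous_def
proof (intro ballI allI impI)
  fix \<gamma> :: "'a curve" and e :: real
  assume \<gamma>: "\<gamma> \<in> curves" and e: "0 < e"
  show "\<exists>\<delta>>0. \<forall>\<gamma>'\<in>curves. curve_dist \<gamma> \<gamma>' < ennreal \<delta> \<longrightarrow> \<bar>path_inf h \<gamma>' - path_inf h \<gamma>\<bar> < e"
  proof (intro exI[of _ e] conjI ballI impI e)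
    fix \<gamma>' :: "'a curve"
    assume \<gamma>': "\<gamma>' \<in> curves" and "curve_dist \<gamma> \<gamma>' < ennreal e"
    then obtain \<psi> where \<psi>: "\<psi> \<in> increasing_homeomorphisms (fst \<gamma>) (fst \<gamma>')"
      and less: "(SUP t\<in>{0..fst \<gamma>}. ennreal (dist (snd \<gamma> t) (snd \<gamma>' (\<psi> t)))) < ennreal e"
      (is "?S < _") unfolding curve_dist_def INF_less_iff by auto
    \<comment> \<open>Pointwise distances below \<open>e\<close> would only bound the difference of
      the infima by \<open>e\<close>; the supremum \<open>c\<close> leaves a gap that makes the
      final inequality strict.\<close>
    define c where "c = enn2real ?S"
    have top: "?S < \<top>" using less ennreal_less_top less_trans by blast
    have S: "?S = ennreal c" using top by (simp add: c_def)
    have c: "c < e" using less e unfolding S by (auto simp: ennreal_less_iff c_def)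
    have "0 \<le> c" by (simp add: c_def)
    have close: "dist (snd \<gamma> t) (snd \<gamma>' (\<psi> t)) \<le> c" if "t \<in> {0..fst \<gamma>}" for t
    proof -
      have "ennreal (dist (snd \<gamma> t) (snd \<gamma>' (\<psi> t))) \<le> ?S" using that by (intro SUP_upper)
      then show ?thesis unfolding S using \<open>0 \<le> c\<close> by (simp add: ennreal_le_iff)
    qed
    have img: "\<psi> ` {0..fst \<gamma>} = {0..fst \<gamma>'}"
      using \<psi> by (auto simp: increasing_homeomorphisms_def homeomorphism_def)
    have T: "0 \<le> fst \<gamma>" "0 \<le> fst \<gamma>'" using \<gamma> \<gamma>' by (auto simp: curves_def)
    have "path_inf h \<gamma>' - c \<le> path_inf h \<gamma>"
    proof (rule le_path_inf[OF T(1)])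
      fix t assume t: "t \<in> {0..fst \<gamma>}"
      then have "path_inf h \<gamma>' \<le> h (snd \<gamma>' (\<psi> t))" using img by (intro path_inf_le nonneg) auto
      then show "path_inf h \<gamma>' - c \<le> h (snd \<gamma> t)"
        using close[OF t] lip[of "snd \<gamma> t" "snd \<gamma>' (\<psi> t)"] by linarith
    qed
    moreover have "path_inf h \<gamma> - c \<le> path_inf h \<gamma>'"
    proof (rule le_path_inf[OF T(2)])
      fix s assume "s \<in> {0..fst \<gamma>'}"
      then obtain t where t: "t \<in> {0..fst \<gamma>}" "s = \<psi> t" using img by blast
      have "path_inf h \<gamma> \<le> h (snd \<gamma> t)" using t by (intro path_inf_le nonneg) auto
      then show "path_inf h \<gamma> - c \<le> h (snd \<gamma>' s)"
        unfolding t(2) using close[OF t(1)] lip[of "snd \<gamma> t" "snd \<gamma>' (\<psi> t)"] by linarith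
    qed
    ultimately show "\<bar>path_inf h \<gamma>' - path_inf h \<gamma>\<bar> < e" using c by linarith
  qed
qed

section \<open>Exit times and measurability of the stopped functional\<close>

lemma exit_time_nonneg: "0 \<le> exit_time U \<gamma>"
  unfolding exit_time_def by (auto intro!: cInf_greatest)

lemma before_exit_time:
  assumes "0 \<le> t" "t < exit_time U \<gamma>"
  shows "\<gamma> t \<in> U"
proof (rule ccontr)
  assume "\<gamma> t \<notin> U"
  then have "exit_time U \<gamma> \<le> t"
    using assms(1) unfolding exit_time_def by (auto intro!: cInf_lower bdd_belowI[of _ 0])
  with assms(2) show False by simp
qed

lemma le_exit_time:
  assumes "\<exists>t\<ge>0. \<gamma> t \<notin> U" "\<And>t. 0 \<le> t \<Longrightarrow> \<gamma> t \<notin> U \<Longrightarrow> q \<le> t"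
  shows "q \<le> exit_time U \<gamma>"
  using assms unfolding exit_time_def by (auto intro!: cInf_greatest)

text \<open>Reduces conditions on a continuum of times to countably many, which is what makes the
  events below measurable.\<close>

lemma ge_on_Icc_if_ge_on_Rats:
  fixes f :: "real \<Rightarrow> real"
  assumes "continuous_on {0..q} f" "0 < q" "\<And>s. s \<in> \<rat> \<Longrightarrow> 0 < s \<Longrightarrow> s < q \<Longrightarrow> c \<le> f s"
    and "s \<in> {0..q}"
  shows "c \<le> f s"
proof -
  have *: "closure ({0<..<q} \<inter> \<rat>) = {0..q}"
    using closure_open_Int_superset[of "{0<..<q}" "\<rat>"] assms(2)
    by (simp add: Rats_closure_real)
  show ?thesis
    by (rule continuous_ge_on_closure[of "{0<..<q} \<inter> \<rat>" f s c]) (use assms * in auto)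
qed

text \<open>On a compact time interval a continuous path stays in an open set iff its distance to
  the complement is bounded below by some \<open>1 / Suc m\<close>, and this bound can be tested at
  rational times.\<close>

lemma sets_stays_in:
  fixes X :: "real \<Rightarrow> 'w \<Rightarrow> 'a::euclidean_space"
  assumes X: "\<And>t. 0 \<le> t \<Longrightarrow> X t \<in> borel_measurable M"
    and cont: "\<And>\<omega> q. \<omega> \<in> space M \<Longrightarrow> continuous_on {0..q} (\<lambda>t. X t \<omega>)"
    and U: "open U" and q: "0 < q"
  shows "{\<omega>\<in>space M. \<forall>s\<in>{0..q}. X s \<omega> \<in> U} \<in> sets M"
\<comment> \<open>\<open>infdist\<close> to the empty set is 0 by convention, so the whole space is
  treated separately.\<close>
proof (cases "U = UNIV")
  case False
  then have ne: "- U \<noteq> {}" by auto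
  let ?d = "\<lambda>\<omega> s. infdist (X s \<omega>) (- U)"
  let ?Q = "\<rat> \<inter> {0<..<q}"
  have pos: "0 < infdist x (- U) \<longleftrightarrow> x \<in> U" for x
    using in_closed_iff_infdist_zero[of "- U" x] U ne infdist_nonneg[of x "- U"]
    by (auto simp: less_le closed_Compl)
  have [measurable]: "(\<lambda>\<omega>. ?d \<omega> s) \<in> borel_measurable M" if "s \<in> ?Q" for s
    using measurable_compose[OF X[of s] borel_measurable_continuous_onI[OF continuous_on_infdist[OF continuous_on_id]]] that
    by auto
  have count: "countable ?Q" by (simp add: countable_rat)
  have "(\<forall>s\<in>{0..q}. X s \<omega> \<in> U) \<longleftrightarrow> (\<exists>m::nat. \<forall>s\<in>?Q. 1 / Suc m \<le> ?d \<omega> s)" (is "?l \<longleftrightarrow> ?r")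
    if \<omega>: "\<omega> \<in> space M" for \<omega>
  proof
    have c: "continuous_on {0..q} (?d \<omega>)" by (intro continuous_intros cont \<omega>)
    show ?r if l: ?l
    proof -
      obtain s0 where s0: "s0 \<in> {0..q}" "\<And>s. s \<in> {0..q} \<Longrightarrow> ?d \<omega> s0 \<le> ?d \<omega> s"
        using continuous_attains_inf[OF _ _ c] q by auto
      obtain m :: nat where m: "1 / Suc m < ?d \<omega> s0"
        using reals_Archimedean[of "?d \<omega> s0"] l s0 pos by (auto simp: inverse_eq_divide)
      show ?r
      proof (intro exI ballI)
        fix s assume "s \<in> ?Q"
        then have "?d \<omega> s0 \<le> ?d \<omega> s" by (intro s0(2)) auto
        then show "1 / Suc m \<le> ?d \<omega> s" using m by linarith
      qed
    qed
    show ?l if ?r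
    proof -
      from that obtain m :: nat where m: "\<forall>s\<in>?Q. 1 / Suc m \<le> ?d \<omega> s" by blast
      show ?l
      proof
        fix s assume "s \<in> {0..q}"
        then have "1 / Suc m \<le> ?d \<omega> s"
            using m by - (rule ge_on_Icc_if_ge_on_Rats[OF c q], simp_all del: of_nat_Suc)
        moreover have "0 < 1 / real (Suc m)" by simp
        ultimately have "0 < ?d \<omega> s" by linarith
        then show "X s \<omega> \<in> U" by (simp only: pos)
      qed
    qed
  qed
  then have "{\<omega>\<in>space M. \<forall>s\<in>{0..q}. X s \<omega> \<in> U} =
      {\<omega>\<in>space M. \<exists>m::nat. \<forall>s\<in>?Q. 1 / Suc m \<le> ?d \<omega> s}"
    by auto
  also have "\<dots> \<in> sets M" using count by measurable
  finally show ?thesis .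
qed simp

text \<open>Needed for the walk, where an almost sure value of the functional has to be turned into
  the value of its integral. The random time interval is handled through rational times
  \<open>q\<close> at which the path has stayed in \<open>U\<close> so far; continuity then covers
  all times up to and including the exit time.\<close>

lemma borel_measurable_path_inf_stopped:
  fixes X :: "real \<Rightarrow> 'w \<Rightarrow> 'a::euclidean_space"
  assumes X: "\<And>t. 0 \<le> t \<Longrightarrow> X t \<in> borel_measurable M"
    and cont: "\<And>\<omega> q. \<omega> \<in> space M \<Longrightarrow> continuous_on {0..q} (\<lambda>t. X t \<omega>)"
    and U: "open U" and h: "continuous_on UNIV h" "\<And>x. 0 \<le> h x"
  shows "(\<lambda>\<omega>. path_inf h (stopped U (\<lambda>t. X t \<omega>))) \<in> borel_measurable M"
proof (rule borel_measurableI_ge)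
  fix y :: real
  define S where "S q \<omega> \<longleftrightarrow> (\<forall>s\<in>{0..q}. X s \<omega> \<in> U)" for q \<omega>
  define L where "L \<omega> \<longleftrightarrow> (\<exists>t\<ge>0. X t \<omega> \<notin> U)" for \<omega>
  let ?Q = "\<rat> \<inter> {0<..} :: real set"
  have S[measurable]: "Measurable.pred M (S q)" if "0 < q" for q
    using sets_stays_in[OF X cont U that] unfolding S_def pred_def by simp
  have L_iff: "L \<omega> \<longleftrightarrow> \<not> (\<forall>n::nat. S (real (Suc n)) \<omega>)" for \<omega>
  proof -
    have "S (real (Suc n)) \<omega>" if "\<not> L \<omega>" for n using that by (auto simp: S_def L_def)
    moreover have "X t \<omega> \<in> U" if a: "\<forall>n::nat. S (real (Suc n)) \<omega>" and t: "0 \<le> t" for t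
    proof -
      obtain n :: nat where "t \<le> n" using real_arch_simple by blast
      then show ?thesis using a[rule_format, of n] t by (auto simp: S_def)
    qed
    ultimately show ?thesis unfolding L_def by blast
  qed
  have L[measurable]: "Measurable.pred M L"
    unfolding L_iff[abs_def] by measurable
  have hX[measurable]: "(\<lambda>\<omega>. h (X q \<omega>)) \<in> borel_measurable M" if "0 \<le> q" for q
    using borel_measurable_continuous_onI[OF h(1)] X[OF that] by measurable
  \<comment> \<open>If the path never leaves \<open>U\<close> (\<open>\<not> L \<omega>\<close>),
    the exit time is 0 by convention and only the value at time 0 counts.\<close>
  have "y \<le> path_inf h (stopped U (\<lambda>t. X t \<omega>)) \<longleftrightarrow>
      y \<le> h (X 0 \<omega>) \<and> (L \<omega> \<longrightarrow> (\<forall>q\<in>?Q. S q \<omega> \<longrightarrow> y \<le> h (X q \<omega>)))" (is "?l \<longleftrightarrow> ?r")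
    if \<omega>: "\<omega> \<in> space M" for \<omega>
  proof -
    let ?T = "exit_time U (\<lambda>t. X t \<omega>)"
    have "?l \<longleftrightarrow> (\<forall>t\<in>{0..?T}. y \<le> h (X t \<omega>))"
      using path_inf_le[of h _ "stopped U (\<lambda>t. X t \<omega>)"] h(2)
      by (auto simp: stopped_def exit_time_nonneg intro!: le_path_inf intro: order_trans)
    also have "\<dots> \<longleftrightarrow> ?r"
    proof (cases "L \<omega>")
      case False
      then have "?T = 0" by (auto simp: L_def exit_time_def)
      with False show ?thesis by auto
    next
      case True
      have ST: "q \<le> ?T" if "S q \<omega>" for q
        using True that by (intro le_exit_time) (force simp: L_def S_def)+
      show ?thesis
      proof
        assume "\<forall>t\<in>{0..?T}. y \<le> h (X t \<omega>)"
        then show ?r using ST exit_time_nonneg[of U "\<lambda>t. X t \<omega>"] by auto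
      next
        assume r: ?r
        show "\<forall>t\<in>{0..?T}. y \<le> h (X t \<omega>)"
        proof
          fix t assume t: "t \<in> {0..?T}"
          show "y \<le> h (X t \<omega>)"
          proof (cases "?T = 0")
            case False
            have "continuous_on {0..?T} (\<lambda>t. h (X t \<omega>))"
              by (rule continuous_on_compose2[OF h(1) cont[OF \<omega>]]) auto
            moreover have "y \<le> h (X s \<omega>)" if "s \<in> \<rat>" "0 < s" "s < ?T" for s
            proof -
              have "S s \<omega>" using that by (auto simp: S_def intro: before_exit_time)
              then show ?thesis using r True that by auto
            qed
            ultimately show ?thesis
              using False t exit_time_nonneg[of U "\<lambda>t. X t \<omega>"]
              by - (rule ge_on_Icc_if_ge_on_Rats[of ?T "\<lambda>t. h (X t \<omega>)" y t], auto)
          qed (use t r in auto)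
        qed
      qed
    qed
    finally show ?thesis .
  qed
  then have "{\<omega>\<in>space M. y \<le> path_inf h (stopped U (\<lambda>t. X t \<omega>))} = {\<omega>\<in>space M.
      y \<le> h (X 0 \<omega>) \<and> (L \<omega> \<longrightarrow> (\<forall>q\<in>?Q. S q \<omega> \<longrightarrow> y \<le> h (X q \<omega>)))}"
    by auto
  also have "\<dots> \<in> sets M"
  proof -
    have "countable ?Q" by (simp add: countable_rat)
    moreover have "Measurable.pred M (\<lambda>\<omega>. S q \<omega> \<longrightarrow> y \<le> h (X q \<omega>))" if "q \<in> ?Q" for q
    proof -
      have [measurable]: "Measurable.pred M (S q)" "(\<lambda>\<omega>. h (X q \<omega>)) \<in> borel_measurable M"
        using S hX that by auto
      show ?thesis by measurable
    qed
    moreover have "Measurable.pred M (\<lambda>\<omega>. y \<le> h (X 0 \<omega>))"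
      using hX[of 0] by measurable
    ultimately show ?thesis by measurable
  qed
  finally show "{\<omega>\<in>space M. y \<le> path_inf h (stopped U (\<lambda>t. X t \<omega>))} \<in> sets M" .
qed

section \<open>Interpolated walks\<close>

lemma interpolate_of_nat [simp]: "interpolate X (real n) = X n"
  by (simp add: interpolate_def frac_def)

text \<open>The affine formula also holds at the right endpoint, where \<open>frac\<close> jumps
  back to 0; hence the pieces agree on closed intervals and can be glued continuously.\<close>

lemma interpolate_on_step:
  assumes "t \<in> {real n..real (Suc n)}"
  shows "interpolate X t = (1 - (t - real n)) *\<^sub>R X n + (t - real n) *\<^sub>R X (Suc n)"
proof (cases "t = real (Suc n)")
  case True
  then show ?thesis using interpolate_of_nat[of X "Suc n"] by simp
next
  case False
  then have "\<lfloor>t\<rfloor> = int n" using assms by (auto simp: floor_unique)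
  then show ?thesis by (simp add: interpolate_def frac_def)
qed

lemma continuous_on_interpolate: "continuous_on {0..q} (interpolate (X :: nat \<Rightarrow> 'a::euclidean_space))"
proof -
  have "continuous_on {0..real n} (interpolate X)" for n
  proof (induction n)
    case (Suc n)
    have "continuous_on {real n..real (Suc n)} (interpolate X)"
      by (subst continuous_on_cong[OF refl interpolate_on_step]) (assumption, intro continuous_intros)
    then have "continuous_on ({0..real n} \<union> {real n..real (Suc n)}) (interpolate X)"
      using Suc by (intro continuous_on_closed_Un) auto
    then show ?case by (simp add: ivl_disj_un_two_touch)
  qed simp
  moreover obtain n :: nat where "q \<le> n" using real_arch_simple by blast
  ultimately show ?thesis by (meson atLeastatMost_subset_iff continuous_on_subset order_refl)
qed

lemma borel_measurable_interpolate:
  assumes "\<And>n. (\<lambda>\<omega>. X \<omega> n) \<in> borel_measurable M"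
  shows "(\<lambda>\<omega>. interpolate (X \<omega>) t :: 'a::euclidean_space) \<in> borel_measurable M"
  unfolding interpolate_def using assms by measurable

text \<open>A coordinate preserved by every step that starts in \<open>U\<close> cannot change
  before the exit; the step during which the exit occurs still starts in \<open>U\<close>.\<close>

lemma inner_interpolate_constant:
  fixes X :: "nat \<Rightarrow> 'a::euclidean_space"
  assumes step: "\<And>k. X k \<in> U \<Longrightarrow> X (Suc k) \<bullet> b = X k \<bullet> b"
    and t: "0 \<le> t" "t \<le> exit_time U (interpolate X)"
  shows "interpolate X t \<bullet> b = X 0 \<bullet> b"
proof -
  \<comment> \<open>The bound \<open>t + 1\<close> includes the vertex at the end of the segment in
    progress at time \<open>t\<close>. The preceding vertex is visited strictly before the exit
    time, hence lies in \<open>U\<close>.\<close>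
  have *: "real m < t + 1 \<Longrightarrow> X m \<bullet> b = X 0 \<bullet> b" for m
  proof (induction m)
    case (Suc m)
    then have "interpolate X (real m) \<in> U" using t by (intro before_exit_time) auto
    then show ?case using Suc step by simp
  qed simp
  define n where "n = nat \<lfloor>t\<rfloor>"
  have n: "real n = of_int \<lfloor>t\<rfloor>" using t(1) by (simp add: n_def)
  have "X n \<bullet> b = X 0 \<bullet> b" by (rule *) (use n in linarith)
  moreover have "frac t = 0 \<or> X (Suc n) \<bullet> b = X 0 \<bullet> b"
  proof (cases "frac t = 0")
    case False
    then have "0 < frac t" using frac_ge_0[of t] by simp
    then have "X (Suc n) \<bullet> b = X 0 \<bullet> b" by (intro *) (use n in \<open>auto simp: frac_def\<close>)
    then show ?thesis ..
  qed simp
  ultimately show ?thesis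
    by (auto simp: interpolate_def n_def[symmetric] inner_add_left algebra_simps)
qed

section \<open>Almost sure properties of the walk\<close>

text \<open>The whole space is the cylinder over the empty index set, whose finite-dimensional
  marginal is a probability measure.\<close>

lemma (in Ionescu_Tulcea) prob_space_lim: "prob_space PF.lim"
proof
  have "emeasure PF.lim (PF.emb UNIV {} {\<lambda>_. undefined}) = emeasure (CI {}) {\<lambda>_. undefined}"
    by (rule lim) (simp_all add: sets_PiM_empty)
  also have "{\<lambda>_. undefined} = space (CI {})" by (simp add: PF.space_P space_PiM)
  also have "emeasure (CI {}) (space (CI {})) = 1"
    by (intro prob_space.emeasure_space_1 PF.prob_space_P) auto
  also have "PF.emb UNIV {} (space (CI {})) = space PF.lim"
    by (auto simp: prod_emb_def PF.space_P space_PiM)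
  finally show "emeasure PF.lim (space PF.lim) = 1" .
qed

text \<open>The law of the first \<open>Suc n\<close> coordinates is the law of the first
  \<open>n\<close> followed by the kernel \<open>P n\<close>, so a set that is null for the kernel
  after every history is null for the limit measure.\<close>

lemma (in Ionescu_Tulcea) AE_lim_step:
  assumes Q: "Measurable.pred (PiM {0..<Suc n} M) Q"
    and AE: "\<And>\<omega>. \<omega> \<in> space (PiM {0..<n} M) \<Longrightarrow> AE y in P n \<omega>. Q (fun_upd \<omega> n y)"
  shows "AE \<omega> in PF.lim. Q (restrict \<omega> {0..<Suc n})"
proof -
  let ?I = "{0..<Suc n}"
  let ?X = "{\<omega>\<in>space (PiM ?I M). \<not> Q \<omega>}"
  have X: "?X \<in> sets (PiM ?I M)" using Q by measurable
  have u: "(\<lambda>_. undefined) \<in> space (PiM {0..<0} M)" by (simp add: space_PiM)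
  have "emeasure (CI ?I) ?X = C 0 (Suc n) (\<lambda>_. undefined) ?X"
    using X by (subst emeasure_CI[of ?I "Suc n"]) (simp_all add: prod_emb_id[OF subset_trans[OF sets.sets_into_space[OF X] eq_refl[OF space_PiM]]] del: C.simps)
  also have "\<dots> = (\<integral>\<^sup>+\<omega>. emeasure (eP n \<omega>) ?X \<partial>C 0 n (\<lambda>_. undefined))"
    using u X by (simp, subst emeasure_bind[where N="PiM ?I M"])
      (auto simp: space_C measurable_cong_sets[OF sets_C refl])
  also have "\<dots> = (\<integral>\<^sup>+\<omega>. 0 \<partial>C 0 n (\<lambda>_. undefined))"
  proof (rule nn_integral_cong)
    fix \<omega> assume "\<omega> \<in> space (C 0 n (\<lambda>_. undefined))"
    then have \<omega>: "\<omega> \<in> space (PiM {0..<n} M)" using u by (simp add: space_C)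
    have "emeasure (eP n \<omega>) ?X = P n \<omega> ((\<lambda>x. fun_upd \<omega> n x) -` ?X \<inter> space (M n))"
      by (rule emeasure_eP[OF \<omega> X])
    also have "\<dots> = 0"
    proof (rule emeasure_eq_0_AE[where P="\<lambda>x. fun_upd \<omega> n x \<in> ?X \<and> x \<in> space (M n)", THEN trans[rotated]])
      show "AE x in P n \<omega>. \<not> (fun_upd \<omega> n x \<in> ?X \<and> x \<in> space (M n))"
        using AE[OF \<omega>] by eventually_elim auto
      show "P n \<omega> ((\<lambda>x. fun_upd \<omega> n x) -` ?X \<inter> space (M n)) =
          P n \<omega> {x \<in> space (P n \<omega>). fun_upd \<omega> n x \<in> ?X \<and> x \<in> space (M n)}"
        by (rule arg_cong[where f="emeasure _"]) (auto simp: space_P[OF \<omega>])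
    qed
    finally show "emeasure (eP n \<omega>) ?X = 0" .
  qed
  finally have "emeasure PF.lim (PF.emb UNIV ?I ?X) = 0"
    using lim[OF _ X] by simp
  then show ?thesis
  proof (rule AE_I[where N="PF.emb UNIV ?I ?X", rotated])
    show "PF.emb UNIV ?I ?X \<in> sets PF.lim" using X by simp
    show "{\<omega> \<in> space PF.lim. \<not> Q (restrict \<omega> ?I)} \<subseteq> PF.emb UNIV ?I ?X"
      by (auto simp: prod_emb_def space_PiM PiE_iff)
  qed
qed

text \<open>The state space is uncountable, and the event relating two successive positions is not
  evidently measurable in the product. Each fixed value \<open>u\<close> of the current position
  gives an event about single coordinates; finitely many \<open>u\<close> suffice, since finite
  degrees keep the set \<open>S i\<close> of vertices reachable in \<open>i\<close> steps
  finite.\<close>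

lemma AE_srw_law:
  fixes x :: "'a::euclidean_space"
  assumes x: "x \<in> V"
    and nb: "\<And>v. v \<in> V \<Longrightarrow> finite (neighbors V r v) \<and> neighbors V r v \<noteq> {}"
  shows "AE \<omega> in srw_law V r x. \<omega> 0 = x \<and> (\<forall>i. \<omega> (Suc i) \<in> neighbors V r (\<omega> i))"
proof -
  let ?N = "neighbors V r"
  define S where "S = rec_nat {x} (\<lambda>_ A. \<Union> (?N ` A))"
  have S0: "S 0 = {x}" and SSuc: "S (Suc i) = \<Union> (?N ` S i)" for i by (simp_all add: S_def)
  have SV: "S i \<subseteq> V \<and> finite (S i)" for i
  proof (induction i)
    case (Suc i)
    then show ?case using nb by (auto simp: SSuc neighbors_def tangent_def)
  qed (use x S0 in auto)
  have comp: "(\<lambda>\<omega>. \<omega> i) \<in> measurable (PiM {0..<Suc n} (\<lambda>_. count_space UNIV)) (count_space UNIV)"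
    if "i \<le> n" for i n using that by (intro measurable_component_singleton) auto
  have start: "AE \<omega> in srw_law V r x. \<omega> 0 = x"
  proof -
    have "AE \<omega> in srw_law V r x. (\<lambda>\<omega>. \<omega> 0 = x) (restrict \<omega> {0..<Suc 0})"
    proof (rule srw.AE_lim_step)
      show "Measurable.pred (PiM {0..<Suc 0} (\<lambda>_. count_space UNIV)) (\<lambda>\<omega>. \<omega> 0 = x)"
        using comp[of 0 0] by measurable
    next
      fix \<omega> :: "nat \<Rightarrow> 'a"
      show "AE y in srw_kernel V r x 0 \<omega>. fun_upd \<omega> 0 y 0 = x"
        unfolding srw_kernel_def by (simp add: AE_measure_pmf_iff)
    qed
    then show ?thesis by simp
  qed
  have step: "AE \<omega> in srw_law V r x. \<omega> i = u \<longrightarrow> \<omega> (Suc i) \<in> ?N u" if "u \<in> V" for i u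
  proof -
    have "AE \<omega> in srw_law V r x.
        (\<lambda>\<omega>. \<omega> i = u \<longrightarrow> \<omega> (Suc i) \<in> ?N u) (restrict \<omega> {0..<Suc (Suc i)})"
    proof (rule srw.AE_lim_step)
      show "Measurable.pred (PiM {0..<Suc (Suc i)} (\<lambda>_. count_space UNIV))
          (\<lambda>\<omega>. \<omega> i = u \<longrightarrow> \<omega> (Suc i) \<in> ?N u)"
      proof -
        have [measurable]: "Measurable.pred (PiM {0..<Suc (Suc i)} (\<lambda>_. count_space UNIV)) (\<lambda>\<omega>. \<omega> i = u)"
          by (rule measurable_compose[OF comp[of i], of _ "\<lambda>y. y = u"]) simp_all
        have [measurable]: "Measurable.pred (PiM {0..<Suc (Suc i)} (\<lambda>_. count_space UNIV)) (\<lambda>\<omega>. \<omega> (Suc i) \<in> ?N u)"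
          by (rule measurable_compose[OF comp[of "Suc i"], of _ "\<lambda>y. y \<in> ?N u"]) simp_all
        show ?thesis by measurable
      qed
    next
      fix \<omega> :: "nat \<Rightarrow> 'a"
      show "AE y in srw_kernel V r x (Suc i) \<omega>.
          fun_upd \<omega> (Suc i) y i = u \<longrightarrow> fun_upd \<omega> (Suc i) y (Suc i) \<in> ?N u"
        unfolding srw_kernel_def using nb[OF that] by (auto simp: AE_measure_pmf_iff)
    qed
    then show ?thesis by simp
  qed
  have main: "AE \<omega> in srw_law V r x. \<omega> i \<in> S i \<and> \<omega> (Suc i) \<in> ?N (\<omega> i)" for i
  proof -
    have all: "AE \<omega> in srw_law V r x. \<forall>u\<in>S i. \<omega> i = u \<longrightarrow> \<omega> (Suc i) \<in> ?N u" for i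
      using SV[of i] by (intro AE_finite_allI step) auto
    have "AE \<omega> in srw_law V r x. \<omega> i \<in> S i"
    proof (induction i)
      case 0
      show ?case using start by eventually_elim (simp add: S0)
    next
      case (Suc i)
      then show ?case using all[of i] by eventually_elim (auto simp: SSuc)
    qed
    then show ?thesis using all[of i] by eventually_elim auto
  qed
  then have "AE \<omega> in srw_law V r x. \<forall>i. \<omega> i \<in> S i \<and> \<omega> (Suc i) \<in> ?N (\<omega> i)"
    by (subst AE_all_countable) auto
  then show ?thesis using start by eventually_elim auto
qed

section \<open>The unit ball as a Lipschitz domain\<close>

text \<open>Above 1/4 the two square roots add up to at least 1, which is the factor between the two
  differences.\<close>

lemma abs_sqrt_diff_le:
  assumes "1 / 4 \<le> A" "1 / 4 \<le> B"
  shows "\<bar>sqrt A - sqrt B\<bar> \<le> \<bar>A - B\<bar>"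
proof -
  have s: "1 / 2 \<le> sqrt A" "1 / 2 \<le> sqrt B"
    by (rule real_le_rsqrt, use assms in \<open>simp add: power2_eq_square\<close>)+
  have "A - B = (sqrt A - sqrt B) * (sqrt A + sqrt B)"
    using assms by (simp add: algebra_simps)
  then have "\<bar>A - B\<bar> = \<bar>sqrt A - sqrt B\<bar> * (sqrt A + sqrt B)"
    using s by (simp add: abs_mult)
  also have "\<dots> \<ge> \<bar>sqrt A - sqrt B\<bar> * 1"
    using s by (intro mult_left_mono) auto
  finally show ?thesis by simp
qed

lemma norm_diff_projection:
  fixes w e :: "'a::real_inner"
  assumes "norm e = 1"
  shows "(norm (w - (w \<bullet> e) *\<^sub>R e))\<^sup>2 = (norm w)\<^sup>2 - (w \<bullet> e)\<^sup>2"
proof -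
  have "e \<bullet> e = 1" using assms by (simp add: dot_square_norm)
  then show ?thesis
    unfolding power2_norm_eq_inner
    by (simp add: inner_diff_left inner_diff_right inner_commute power2_eq_square algebra_simps)
qed

text \<open>Near a boundary point \<open>p\<close> the ball is the region above the hemisphere
  through \<open>p\<close>, seen along the inner normal \<open>e = z - p\<close>.\<close>

lemma bounded_lipschitz_domain_ball: "bounded_lipschitz_domain (ball (z :: 'a::euclidean_space) 1)"
  unfolding bounded_lipschitz_domain_def
proof (intro conjI ballI)
  fix p assume "p \<in> frontier (ball z 1)"
  then have e1: "norm (z - p) = 1" by (simp add: dist_norm)
  define e where "e = z - p"
  have e: "norm e = 1" "e \<bullet> e = 1" using e1 by (simp_all add: e_def dot_square_norm)
  \<comment> \<open>The distance to the axis is cut off at 1/2, so that the hemisphere formula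
    \<open>g\<close> is defined and Lipschitz on the whole hyperplane. Inside the ball of radius 1/2
    around \<open>p\<close> the cutoff is inactive.\<close>
  define \<rho> where "\<rho> y = min (norm (y - (z - (z \<bullet> e) *\<^sub>R e))) (1 / 2)" for y
  define g where "g y = z \<bullet> e - sqrt (1 - (\<rho> y)\<^sup>2)" for y
  have \<rho>: "0 \<le> \<rho> y" "\<rho> y \<le> 1 / 2" "(\<rho> y)\<^sup>2 \<le> 1 / 4" for y
  proof -
    show *: "0 \<le> \<rho> y" "\<rho> y \<le> 1 / 2" by (auto simp: \<rho>_def)
    show "(\<rho> y)\<^sup>2 \<le> 1 / 4" using power_mono[OF *(2,1), of 2] by (simp add: power2_eq_square)
  qed
  have lip: "1-lipschitz_on {y. y \<bullet> e = 0} g"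
  proof (rule lipschitz_onI)
    fix y y'
    have "dist (g y) (g y') = \<bar>sqrt (1 - (\<rho> y)\<^sup>2) - sqrt (1 - (\<rho> y')\<^sup>2)\<bar>"
      by (simp add: g_def dist_real_def abs_minus_commute)
    also have "\<dots> \<le> \<bar>(1 - (\<rho> y)\<^sup>2) - (1 - (\<rho> y')\<^sup>2)\<bar>"
      using \<rho>(3)[of y] \<rho>(3)[of y'] by (intro abs_sqrt_diff_le) linarith+
    also have "\<dots> = \<bar>\<rho> y - \<rho> y'\<bar> * (\<rho> y + \<rho> y')"
    proof -
      have "(1 - (\<rho> y)\<^sup>2) - (1 - (\<rho> y')\<^sup>2) = (\<rho> y' - \<rho> y) * (\<rho> y + \<rho> y')"
        by (simp add: power2_eq_square algebra_simps)
      then show ?thesis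
        using \<rho>(1)[of y] \<rho>(1)[of y'] by (simp add: abs_mult abs_minus_commute)
    qed
    also have "\<dots> \<le> \<bar>\<rho> y - \<rho> y'\<bar> * 1"
      using \<rho>(2)[of y] \<rho>(2)[of y'] by (intro mult_left_mono) linarith+
    also have "\<dots> \<le> dist y y'"
    proof -
      have "\<bar>min u (1 / 2) - min v (1 / 2)\<bar> \<le> \<bar>u - v\<bar>" for u v :: real by linarith
      moreover have "\<bar>norm (y - c) - norm (y' - c)\<bar> \<le> dist y y'" for c
        using norm_triangle_ineq3[of "y - c" "y' - c"] by (simp add: dist_norm)
      ultimately show ?thesis unfolding \<rho>_def mult_1_right by (rule order_trans)
    qed
    finally show "dist (g y) (g y') \<le> 1 * dist y y'" by simp
  qed simp
  have "x \<in> ball z 1 \<longleftrightarrow> g (x - (x \<bullet> e) *\<^sub>R e) < x \<bullet> e" if x: "x \<in> ball p (1 / 2)" for x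
  proof -
    define w q v where "w = x - z" and "q = x - p" and "v = w - (w \<bullet> e) *\<^sub>R e"
    have q: "norm q < 1 / 2" using x by (simp add: q_def dist_norm norm_minus_commute)
    have wq: "w = q - e" by (simp add: w_def q_def e_def)
    have "\<bar>q \<bullet> e\<bar> \<le> norm q" using Cauchy_Schwarz_ineq2[of q e] e by simp
    then have we: "w \<bullet> e < 0" using q e by (simp add: wq inner_diff_left)
    have "v = q - (q \<bullet> e) *\<^sub>R e" using e by (simp add: v_def wq inner_diff_left algebra_simps)
    then have "(norm v)\<^sup>2 \<le> (norm q)\<^sup>2" using norm_diff_projection[OF e(1), of q] by simp
    then have v: "norm v < 1 / 2" using q by (smt (verit) norm_ge_zero power2_le_imp_le)
    have "x - (x \<bullet> e) *\<^sub>R e - (z - (z \<bullet> e) *\<^sub>R e) = v"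
      by (simp add: v_def w_def inner_diff_left algebra_simps)
    then have \<rho>v: "\<rho> (x - (x \<bullet> e) *\<^sub>R e) = norm v" using v by (simp add: \<rho>_def)
    have v1: "(norm v)\<^sup>2 = (norm w)\<^sup>2 - (w \<bullet> e)\<^sup>2"
      unfolding v_def by (rule norm_diff_projection[OF e(1)])
    have "x \<in> ball z 1 \<longleftrightarrow> (norm w)\<^sup>2 < 1\<^sup>2"
      using power2_less_imp_less[of "norm w" 1] power_strict_mono[of "norm w" 1 2]
      by (auto simp: w_def dist_norm norm_minus_commute)
    also have "\<dots> \<longleftrightarrow> (w \<bullet> e)\<^sup>2 < 1 - (norm v)\<^sup>2" using v1 by auto
    also have "\<dots> \<longleftrightarrow> \<bar>w \<bullet> e\<bar> < sqrt (1 - (norm v)\<^sup>2)"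
      by (metis real_sqrt_abs real_sqrt_less_iff)
    also have "\<dots> \<longleftrightarrow> g (x - (x \<bullet> e) *\<^sub>R e) < x \<bullet> e"
      using we by (auto simp: g_def \<rho>v w_def inner_diff_left)
    finally show ?thesis .
  qed
  then have "ball z 1 \<inter> ball p (1 / 2) = {x \<in> ball p (1 / 2). g (x - (x \<bullet> e) *\<^sub>R e) < x \<bullet> e}"
    by blast
  with e(1) lip show "\<exists>\<rho>>0. \<exists>e g L. norm e = 1 \<and> L-lipschitz_on {y. y \<bullet> e = 0} g \<and>
      ball z 1 \<inter> ball p \<rho> = {x \<in> ball p \<rho>. g (x - (x \<bullet> e) *\<^sub>R e) < x \<bullet> e}"
    by (intro exI[of _ "1 / 2 :: real"] conjI exI[of _ e] exI[of _ g] exI[of _ 1]) auto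
qed auto

section \<open>Brownian motion\<close>

text \<open>The Gaussian density is positive everywhere, so the law of the displacement at a
  positive time has the same null sets as Lebesgue measure.\<close>

lemma brownian_motion_AE_iff:
  fixes z :: "'a::euclidean_space"
  assumes B: "brownian_motion M B z" and t: "0 < t" and [measurable]: "Measurable.pred borel P"
  shows "(AE \<omega> in M. P (B t \<omega> - z)) \<longleftrightarrow> (AE x in lborel. P x)"
proof -
  interpret prob_space M using B by (simp add: brownian_motion_def)
  let ?f = "\<lambda>x::'a. \<Prod>b\<in>Basis. ennreal (normal_density 0 (sqrt (t - 0)) (x \<bullet> b))"
  have "distributed M lborel (\<lambda>\<omega>. B t \<omega> - B 0 \<omega>) ?f"
    using B t unfolding brownian_motion_def by blast
  then have "(AE \<omega> in M. P (B t \<omega> - B 0 \<omega>)) \<longleftrightarrow> (AE x in lborel. 0 < ?f x \<longrightarrow> P x)"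
    by (rule distributed_AE2) simp
  moreover have "0 < ?f x" for x
    using t by (auto simp: zero_less_iff_neq_zero prod_zero_iff normal_density_pos ennreal_eq_0_iff not_le)
  moreover have "AE \<omega> in M. B 0 \<omega> = z" using B by (simp add: brownian_motion_def)
  then have "(AE \<omega> in M. P (B t \<omega> - B 0 \<omega>)) \<longleftrightarrow> (AE \<omega> in M. P (B t \<omega> - z))"
    by (intro eventually_subst) (auto elim: eventually_mono)
  ultimately show ?thesis by simp
qed

lemma brownian_motion_AE_inner_neq:
  assumes "brownian_motion M B z" "0 < t" "b \<in> Basis"
  shows "AE \<omega> in M. B t \<omega> \<bullet> b \<noteq> z \<bullet> b"
proof -
  have "AE \<omega> in M. (B t \<omega> - z) \<bullet> b \<noteq> 0"
    by (subst brownian_motion_AE_iff[OF assms(1,2), where P="\<lambda>x. x \<bullet> b \<noteq> 0"])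
      (use AE_lborel_inner_neq[OF assms(3), of 0] in auto)
  then show ?thesis by eventually_elim (simp add: inner_diff_left)
qed

lemma brownian_motion_leaves_ball:
  fixes z :: "'a::euclidean_space"
  assumes "brownian_motion M B z" "0 < t" "0 < R"
  shows "\<not> (AE \<omega> in M. B t \<omega> \<in> ball z R)"
proof
  assume "AE \<omega> in M. B t \<omega> \<in> ball z R"
  then have "AE \<omega> in M. B t \<omega> - z \<in> ball 0 R"
    by eventually_elim (simp add: dist_norm norm_minus_commute)
  then have AE: "AE x in lborel. x \<in> ball (0::'a) R"
    by (subst (asm) brownian_motion_AE_iff[OF assms(1,2)]) auto
  obtain b :: 'a where b: "b \<in> Basis" using nonempty_Basis by blast
  \<comment> \<open>At distance \<open>2 * R\<close> the translated open ball is disjoint from the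
    original one, so it would have Lebesgue measure 0.\<close>
  let ?c = "(2 * R) *\<^sub>R b"
  have "x \<notin> ball ?c R" if "x \<in> ball 0 R" for x
    using that norm_triangle_ineq2[of ?c x] norm_Basis[OF b] assms(3) by (auto simp: dist_norm)
  then have "AE x in lborel. x \<notin> ball ?c R" using AE by (auto elim: eventually_mono)
  then have "ball ?c R \<in> null_sets lborel" by (subst AE_iff_null_sets) simp_all
  then have "emeasure lborel (ball ?c R) = 0" by (rule null_setsD1)
  then show False using content_ball_pos[OF assms(3), of ?c] by (simp add: measure_def)
qed

section \<open>The comb packing\<close>

text \<open>
  The sublattice of \<open>2\<int>\<^sup>d\<close> whose points lie in the hyperplane orthogonal to \<open>a\<close> or on one of the
  teeth, which are at distance 4 from each other.
\<close>

definition comb :: "'a::euclidean_space \<Rightarrow> 'a set" where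
  "comb a = {v. (\<forall>b\<in>Basis. v \<bullet> b / 2 \<in> \<int>) \<and> (v \<bullet> a = 0 \<or> (\<forall>b\<in>Basis - {a}. v \<bullet> b / 4 \<in> \<int>))}"

lemma comb_inner_diff:
  assumes "u \<in> comb a" "v \<in> comb a" "b \<in> Basis" "u \<bullet> b \<noteq> v \<bullet> b"
  shows "2 \<le> \<bar>u \<bullet> b - v \<bullet> b\<bar>"
proof -
  have "u \<bullet> b / 2 - v \<bullet> b / 2 \<in> \<int>" using assms by (intro Ints_diff) (auto simp: comb_def)
  then have "1 \<le> \<bar>u \<bullet> b / 2 - v \<bullet> b / 2\<bar>" using assms(4) by (intro Ints_nonzero_abs_ge1) auto
  then show ?thesis by linarith
qed

lemma comb_dist:
  assumes "u \<in> comb a" "v \<in> comb a" "u \<noteq> v"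
  shows "2 \<le> dist u v"
proof -
  obtain b where b: "b \<in> Basis" "u \<bullet> b \<noteq> v \<bullet> b" using assms(3) euclidean_eq_iff[of u v] by blast
  have "2 \<le> \<bar>(u - v) \<bullet> b\<bar>" using comb_inner_diff[OF assms(1,2) b] by (simp add: inner_diff_left)
  also have "\<dots> \<le> dist u v" using Basis_le_norm[OF b(1)] by (simp add: dist_norm)
  finally show ?thesis .
qed

text \<open>A coordinate in which the points differ already contributes 2, the full length of
  \<open>v - u\<close>; by Pythagoras nothing is left for the other coordinates.\<close>

lemma comb_dist_eq_2:
  assumes "u \<in> comb a" "v \<in> comb a" "dist u v = 2"
  obtains b s where "b \<in> Basis" "s \<in> {2, -2}" "v = u + s *\<^sub>R b"
proof -
  define w where "w = v - u"
  have w: "norm w = 2" using assms(3) by (simp add: w_def dist_norm norm_minus_commute)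
  have "v \<noteq> u" using assms(3) by auto
  then obtain b where b: "b \<in> Basis" "v \<bullet> b \<noteq> u \<bullet> b" using euclidean_eq_iff[of u v] by metis
  have "2 \<le> \<bar>w \<bullet> b\<bar>"
    using comb_inner_diff[OF assms(2,1) b] by (simp add: w_def inner_diff_left)
  moreover have "\<bar>w \<bullet> b\<bar> \<le> 2" using Basis_le_norm[OF b(1), of w] w by simp
  ultimately have wb: "\<bar>w \<bullet> b\<bar> = 2" by simp
  then have "(w \<bullet> b)\<^sup>2 = 4" using power2_abs[of "w \<bullet> b"] by simp
  then have "norm (w - (w \<bullet> b) *\<^sub>R b) = 0"
    using norm_diff_projection[OF norm_Basis[OF b(1)], of w] w by simp
  then have "v = u + (w \<bullet> b) *\<^sub>R b" by (simp add: w_def algebra_simps)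
  with b wb show ?thesis by (intro that[of b "w \<bullet> b"]) auto
qed

lemma neighbors_comb:
  "v \<in> comb a \<Longrightarrow> neighbors (comb a) (\<lambda>_. 1) v = {u \<in> comb a. dist v u = 2}"
  by (auto simp: neighbors_def tangent_def)

lemma finite_neighbors_comb:
  fixes a :: "'a::euclidean_space"
  assumes "v \<in> comb a"
  shows "finite (neighbors (comb a) (\<lambda>_. 1) v) \<and> card (neighbors (comb a) (\<lambda>_. 1) v) \<le> 2 * DIM('a)"
proof -
  let ?A = "(\<lambda>(b, s). v + s *\<^sub>R b) ` (Basis \<times> {2, -2 :: real})"
  have sub: "neighbors (comb a) (\<lambda>_. 1) v \<subseteq> ?A"
    using assms by (auto simp: neighbors_comb elim!: comb_dist_eq_2[OF assms])
  have fin: "finite ?A" by simp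
  have "card ?A \<le> card (Basis \<times> {2, -2 :: real} :: ('a \<times> real) set)" by (rule card_image_le) simp
  also have "\<dots> = 2 * DIM('a)" by (simp add: card_cartesian_product)
  finally show ?thesis using card_mono[OF fin sub] finite_subset[OF sub fin] by linarith
qed

section \<open>Moves within the comb, connectedness and density\<close>

text \<open>Off the hyperplane a move along \<open>a\<close> stays on its tooth; in the hyperplane a
  move transverse to \<open>a\<close> stays there. Such moves lead from any vertex to the origin:
  down the tooth, then through the hyperplane.\<close>

lemma comb_add:
  assumes v: "v \<in> comb a" and a: "a \<in> Basis" and b: "b \<in> Basis" and s: "s / 2 \<in> \<int>"
    and ab: "v \<bullet> a \<noteq> 0 \<Longrightarrow> b = a" "v \<bullet> a = 0 \<Longrightarrow> b \<noteq> a"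
  shows "v + s *\<^sub>R b \<in> comb a"
proof -
  have "(v + s *\<^sub>R b) \<bullet> c / 2 \<in> \<int>" if "c \<in> Basis" for c
  proof (cases "c = b")
    case True
    then have "(v + s *\<^sub>R b) \<bullet> c / 2 = v \<bullet> c / 2 + s / 2"
      using b by (simp add: inner_add_left add_divide_distrib)
    moreover have "v \<bullet> c / 2 \<in> \<int>" using v that by (simp add: comb_def)
    ultimately show ?thesis using s by (metis Ints_add)
  next
    case False
    then show ?thesis using v that b by (auto simp: comb_def inner_add_left inner_Basis)
  qed
  moreover have "(v + s *\<^sub>R b) \<bullet> a = 0 \<or> (\<forall>c\<in>Basis - {a}. (v + s *\<^sub>R b) \<bullet> c / 4 \<in> \<int>)"
  proof (cases "v \<bullet> a = 0")
    case True
    then show ?thesis using ab a b by (auto simp: inner_add_left inner_Basis)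
  next
    case False
    then show ?thesis using v ab(1) a by (auto simp: comb_def inner_add_left inner_Basis)
  qed
  ultimately show ?thesis by (simp add: comb_def)
qed

lemma zero_in_comb: "0 \<in> comb a"
  by (simp add: comb_def)

lemma neighbors_comb_nonempty:
  assumes "v \<in> comb a" "a \<in> Basis" "b \<in> Basis" "a \<noteq> b"
  shows "neighbors (comb a) (\<lambda>_. 1) v \<noteq> {}"
proof -
  define c where "c = (if v \<bullet> a = 0 then b else a)"
  have "v + 2 *\<^sub>R c \<in> comb a"
    using assms by (intro comb_add) (auto simp: c_def split: if_splits)
  moreover have "dist v (v + 2 *\<^sub>R c) = 2" using assms by (simp add: c_def dist_norm)
  ultimately show ?thesis using assms(1) by (auto simp: neighbors_comb)
qed

lemma comb_step_towards_zero:
  assumes v: "v \<in> comb a" "v \<noteq> 0" and a: "a \<in> Basis"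
  obtains u where "u \<in> comb a" "dist v u = 2" "(norm u)\<^sup>2 \<le> (norm v)\<^sup>2 - 4"
proof -
  obtain b where b: "b \<in> Basis" "v \<bullet> b \<noteq> 0" "v \<bullet> a \<noteq> 0 \<Longrightarrow> b = a" "v \<bullet> a = 0 \<Longrightarrow> b \<noteq> a"
  proof (cases "v \<bullet> a = 0")
    case True
    obtain b where "b \<in> Basis" "v \<bullet> b \<noteq> 0" using v(2) euclidean_all_zero_iff[of v] by blast
    then show ?thesis using that[of b] True by auto
  qed (use that[of a] a in auto)
  \<comment> \<open>The step has length 2 and points towards 0. It changes the squared norm by
    \<open>4 - 4 * \<bar>v \<bullet> b\<bar>\<close>, which is at most -4 because nonzero
    coordinates have absolute value at least 2.\<close>
  define s where "s = - 2 * sgn (v \<bullet> b)"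
  have "2 \<le> \<bar>v \<bullet> b\<bar>" using comb_inner_diff[OF v(1) zero_in_comb b(1)] b(2) by simp
  then have s: "s\<^sup>2 + 2 * s * (v \<bullet> b) \<le> - 4" "\<bar>s\<bar> = 2" "s / 2 \<in> \<int>"
    by (auto simp: s_def sgn_if split: if_splits)
  have bb: "b \<bullet> b = 1" using b by simp
  have "(norm (v + s *\<^sub>R b))\<^sup>2 = (norm v)\<^sup>2 + (s\<^sup>2 + 2 * s * (v \<bullet> b))"
    unfolding power2_norm_eq_inner
    by (simp add: inner_add_left inner_add_right inner_commute[of b v] bb power2_eq_square algebra_simps)
  then have "(norm (v + s *\<^sub>R b))\<^sup>2 \<le> (norm v)\<^sup>2 - 4" using s by simp
  moreover have "v + s *\<^sub>R b \<in> comb a" using b s by (intro comb_add[OF v(1) a]) auto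
  moreover have "dist v (v + s *\<^sub>R b) = 2" using s b by (simp add: dist_norm)
  ultimately show ?thesis using that by blast
qed

lemma tangency_connected_comb:
  assumes a: "a \<in> Basis"
  shows "tangency_connected (comb a) (\<lambda>_. 1)"
proof -
  let ?T = "tangent (comb a) (\<lambda>_. 1)"
  have sym: "symp ?T" by (auto simp: symp_def tangent_def dist_commute)
  have "(norm v)\<^sup>2 \<le> 4 * real n \<Longrightarrow> v \<in> comb a \<Longrightarrow> ?T\<^sup>*\<^sup>* v 0" for v n
  proof (induction n arbitrary: v)
    case (Suc n)
    show ?case
    proof (cases "v = 0")
      case False
      obtain u where u: "u \<in> comb a" "dist v u = 2" "(norm u)\<^sup>2 \<le> (norm v)\<^sup>2 - 4"
        using comb_step_towards_zero[OF Suc.prems(2) False a] .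
      then have "?T v u" using Suc.prems by (auto simp: tangent_def)
      moreover have "?T\<^sup>*\<^sup>* u 0" using u Suc.prems by (intro Suc.IH) auto
      ultimately show ?thesis by (rule converse_rtranclp_into_rtranclp)
    qed simp
  qed simp
  moreover have "\<exists>n. (norm v)\<^sup>2 \<le> 4 * real n" for v :: 'a
    using real_arch_simple[of "(norm v)\<^sup>2 / 4"] by (auto simp: field_simps)
  ultimately have to_0: "?T\<^sup>*\<^sup>* v 0" if "v \<in> comb a" for v using that by blast
  show ?thesis
    unfolding tangency_connected_def
  proof (intro ballI)
    fix u v assume "u \<in> comb a" "v \<in> comb a"
    then show "?T\<^sup>*\<^sup>* u v"
      using to_0[of u] sympD[OF symp_rtranclp[OF sym] to_0[of v]] by (meson rtranclp_trans)
  qed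
qed

text \<open>Points of the coarser lattice with all coordinates divisible by 4 belong to every comb,
  so rounding each coordinate down to a multiple of 4 suffices.\<close>

lemma comb_near:
  fixes a z :: "'a::euclidean_space"
  shows "\<exists>v\<in>comb a. dist z v \<le> 4 * DIM('a)"
proof
  let ?v = "\<Sum>b\<in>Basis. (4 * of_int \<lfloor>z \<bullet> b / 4\<rfloor>) *\<^sub>R b"
  have v: "?v \<bullet> b = 4 * of_int \<lfloor>z \<bullet> b / 4\<rfloor>" if "b \<in> Basis" for b
    using that by (simp add: inner_sum_left_Basis)
  have "4 * real_of_int k / 2 \<in> \<int>" for k
    using Ints_of_int[of "2 * k"] by simp
  then show "?v \<in> comb a" unfolding comb_def using v by simp
  have "dist z ?v \<le> (\<Sum>b\<in>Basis. \<bar>(z - ?v) \<bullet> b\<bar>)" unfolding dist_norm by (rule norm_le_l1)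
  also have "\<dots> \<le> (\<Sum>b\<in>(Basis :: 'a set). 4)"
  proof (rule sum_mono)
    fix b :: 'a assume "b \<in> Basis"
    then have "(z - ?v) \<bullet> b = z \<bullet> b - 4 * of_int \<lfloor>z \<bullet> b / 4\<rfloor>" by (simp add: inner_diff_left v)
    then show "\<bar>(z - ?v) \<bullet> b\<bar> \<le> 4" by linarith
  qed
  finally show "dist z ?v \<le> 4 * DIM('a)" by simp
qed

text \<open>Away from the hyperplane \<open>v \<bullet> a = 0\<close> the walk moves along a single tooth.\<close>

lemma comb_neighbor_inner:
  assumes u: "u \<in> comb a" "u \<bullet> a \<noteq> 0" and v: "v \<in> neighbors (comb a) (\<lambda>_. 1) u"
    and a: "a \<in> Basis" and c: "c \<in> Basis" "c \<noteq> a"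
  shows "v \<bullet> c = u \<bullet> c"
proof -
  have v': "v \<in> comb a" "dist u v = 2" using v u by (auto simp: neighbors_comb)
  obtain b s where bs: "b \<in> Basis" "s \<in> {2, -2 :: real}" "v = u + s *\<^sub>R b"
    using comb_dist_eq_2[OF u(1) v'] .
  show ?thesis
  proof (cases "b = c")
    case True
    \<comment> \<open>A transverse step would leave \<open>v \<bullet> a\<close> nonzero, so both
      ends would have \<open>c\<close>-coordinates divisible by 4, although they differ by
      2.\<close>
    then have "v \<bullet> a = u \<bullet> a" using bs a c by (simp add: inner_add_left inner_Basis)
    then have "v \<bullet> c / 4 - u \<bullet> c / 4 \<in> \<int>" using u v' c by (intro Ints_diff) (auto simp: comb_def)
    moreover have "v \<bullet> c / 4 - u \<bullet> c / 4 = s / 4"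
      using bs True by (simp add: inner_add_left add_divide_distrib)
    ultimately have "s / 4 \<in> \<int>" by simp
    then have "1 \<le> \<bar>s / 4\<bar>" using bs by (intro Ints_nonzero_abs_ge1) auto
    then show ?thesis using bs by auto
  qed (use bs c in \<open>simp add: inner_add_left inner_Basis\<close>)
qed

text \<open>The minimum distance 2 between vertices makes the scaled comb closed, so that the
  closest point is attained; the error is the covering radius bound of the comb, scaled.\<close>

lemma nearest_vertex_comb:
  fixes a z :: "'a::euclidean_space"
  assumes \<epsilon>: "0 < \<epsilon>"
  shows "nearest_vertex (comb a) \<epsilon> z \<in> comb a"
    and "dist z (\<epsilon> *\<^sub>R nearest_vertex (comb a) \<epsilon> z) \<le> \<epsilon> * (4 * DIM('a))"
proof -
  let ?S = "(\<lambda>v. \<epsilon> *\<^sub>R v) ` comb a"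
  let ?p = "closest_point ?S z"
  have cl: "closed ?S"
  proof (rule closed_scaling[OF discrete_imp_closed])
    show "\<forall>x\<in>comb a. \<forall>y\<in>comb a. dist y x < 2 \<longrightarrow> y = x" using comb_dist by force
  qed simp
  have "?p \<in> ?S" using zero_in_comb by (intro closest_point_in_set cl) auto
  then show "nearest_vertex (comb a) \<epsilon> z \<in> comb a"
    using \<epsilon> by (auto simp: nearest_vertex_def)
  obtain v where v: "v \<in> comb a" "dist (z /\<^sub>R \<epsilon>) v \<le> 4 * DIM('a)" using comb_near by blast
  have "dist z ?p \<le> dist z (\<epsilon> *\<^sub>R v)" using v by (intro closest_point_le cl) auto
  also have "z - \<epsilon> *\<^sub>R v = \<epsilon> *\<^sub>R (z /\<^sub>R \<epsilon> - v)" using \<epsilon> by (simp add: algebra_simps)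
  then have "dist z (\<epsilon> *\<^sub>R v) = \<epsilon> * dist (z /\<^sub>R \<epsilon>) v" using \<epsilon> by (simp add: dist_norm)
  also have "\<dots> \<le> \<epsilon> * (4 * DIM('a))" using v \<epsilon> by (intro mult_left_mono) auto
  finally show "dist z (\<epsilon> *\<^sub>R nearest_vertex (comb a) \<epsilon> z) \<le> \<epsilon> * (4 * DIM('a))"
    using \<epsilon> by (simp add: nearest_vertex_def)
qed

section \<open>Failure of convergence\<close>

text \<open>Takes its maximum 1 exactly where the \<open>b\<close>-coordinate vanishes; the cutoff
  at 0 makes the functional bounded.\<close>

definition tent :: "'a::euclidean_space \<Rightarrow> 'a \<Rightarrow> real" where
  "tent b x = max 0 (1 - \<bar>x \<bullet> b\<bar>)"

lemma tent_nonneg: "0 \<le> tent b x" and tent_le_1: "tent b x \<le> 1"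
  by (auto simp: tent_def)

lemma tent_lipschitz:
  assumes "b \<in> Basis"
  shows "\<bar>tent b x - tent b y\<bar> \<le> dist x y"
  using Basis_le_norm[OF assms, of "x - y"] by (auto simp: tent_def dist_norm inner_diff_left)

lemma continuous_on_tent: "continuous_on UNIV (tent b)"
  unfolding tent_def[abs_def] by (intro continuous_intros)

text \<open>Almost surely the functional is constant, since the \<open>b\<close>-coordinate does not
  move before the exit. The identity is exact at every scale and leaves only the position of the
  starting vertex to control.\<close>

lemma integral_srw_comb:
  fixes a b :: "'a::euclidean_space"
  assumes a: "a \<in> Basis" and b: "b \<in> Basis" "b \<noteq> a" and x: "x \<in> comb a" and \<epsilon>: "0 < \<epsilon>"
  shows "(\<integral>\<omega>. path_inf (tent b) (stopped (ball (2 *\<^sub>R a) 1) (interpolate (\<lambda>n. \<epsilon> *\<^sub>R \<omega> n)))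
      \<partial>srw_law (comb a) (\<lambda>_. 1) x) = tent b (\<epsilon> *\<^sub>R x)"
proof -
  let ?U = "ball (2 *\<^sub>R a) 1"
  let ?M = "srw_law (comb a) (\<lambda>_. 1) x"
  interpret M: prob_space ?M by (rule srw.prob_space_lim)
  let ?F = "\<lambda>\<omega>. path_inf (tent b) (stopped ?U (interpolate (\<lambda>n. \<epsilon> *\<^sub>R \<omega> n)))"
  have "(\<lambda>\<omega>. \<epsilon> *\<^sub>R \<omega> n) \<in> borel_measurable ?M" for n
    by (rule measurable_compose[where N="count_space UNIV" and g="\<lambda>y. \<epsilon> *\<^sub>R y"])
      (auto intro: measurable_component_singleton simp: measurable_cong_sets[OF srw.PF.sets_lim refl])
  then have meas: "?F \<in> borel_measurable ?M"
    by (intro borel_measurable_path_inf_stopped[where X="\<lambda>t \<omega>. interpolate (\<lambda>n. \<epsilon> *\<^sub>R \<omega> n) t"]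
        borel_measurable_interpolate continuous_on_interpolate continuous_on_tent tent_nonneg) auto
  have "AE \<omega> in ?M. \<omega> 0 = x \<and> (\<forall>i. \<omega> (Suc i) \<in> neighbors (comb a) (\<lambda>_. 1) (\<omega> i))"
    using finite_neighbors_comb neighbors_comb_nonempty[OF _ a b(1)] b(2) by (intro AE_srw_law x) blast
  then have "AE \<omega> in ?M. ?F \<omega> = tent b (\<epsilon> *\<^sub>R x)"
  proof eventually_elim
    fix \<omega> assume \<omega>: "\<omega> 0 = x \<and> (\<forall>i. \<omega> (Suc i) \<in> neighbors (comb a) (\<lambda>_. 1) (\<omega> i))"
    let ?X = "\<lambda>n. \<epsilon> *\<^sub>R \<omega> n"
    have comb: "\<omega> i \<in> comb a" for i
      using x \<omega> by (cases i) (auto simp: neighbors_def tangent_def)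
    have step: "?X (Suc k) \<bullet> b = ?X k \<bullet> b" if "?X k \<in> ?U" for k
    proof -
      \<comment> \<open>In the unit ball around \<open>2 *\<^sub>R a\<close> the
        \<open>a\<close>-coordinate exceeds 1, so the walk is off the hyperplane at every
        scale.\<close>
      have "\<bar>(2 *\<^sub>R a - ?X k) \<bullet> a\<bar> < 1"
        using Basis_le_norm[OF a, of "2 *\<^sub>R a - ?X k"] that by (simp add: dist_norm)
      then have "\<omega> k \<bullet> a \<noteq> 0" using a by (auto simp: inner_diff_left)
      then show ?thesis using comb_neighbor_inner[OF comb _ _ a b, of k "\<omega> (Suc k)"] \<omega> by simp
    qed
    have "tent b (interpolate ?X t) = tent b (\<epsilon> *\<^sub>R x)" if "t \<in> {0..exit_time ?U (interpolate ?X)}" for t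
      using inner_interpolate_constant[of ?X ?U b t, OF step] that \<omega> by (simp add: tent_def)
    then show "?F \<omega> = tent b (\<epsilon> *\<^sub>R x)"
      using exit_time_nonneg[of ?U "interpolate ?X"] by (simp add: path_inf_def stopped_def)
  qed
  then have "(\<integral>\<omega>. ?F \<omega> \<partial>?M) = (\<integral>\<omega>. tent b (\<epsilon> *\<^sub>R x) \<partial>?M)"
    by (intro integral_cong_AE meas) auto
  also have "\<dots> = tent b (\<epsilon> *\<^sub>R x)" using M.prob_space by simp
  finally show ?thesis .
qed

lemma path_inf_tent_bounds:
  assumes "0 \<le> fst \<gamma>"
  shows "0 \<le> path_inf (tent b) \<gamma>" "path_inf (tent b) \<gamma> \<le> 1"
proof -
  show "0 \<le> path_inf (tent b) \<gamma>" using assms by (rule le_path_inf) (rule tent_nonneg)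
  have "path_inf (tent b) \<gamma> \<le> tent b (snd \<gamma> 0)" using assms by (intro path_inf_le tent_nonneg) auto
  then show "path_inf (tent b) \<gamma> \<le> 1" using tent_le_1 order_trans by blast
qed

text \<open>
  The functional is normalized to have integral 1 on a line, so that integrability is automatic (the
  integral of a non-integrable function being 0) and no measurability for \<open>B\<close> is needed. Paths
  that never leave the ball have exit time 0 and hence also functional 1, which is why the argument
  ends in a contradiction to \<open>B 1\<close> leaving the ball with positive probability.
\<close>

lemma brownian_motion_not_on_line:
  fixes z :: "'a::euclidean_space"
  assumes B: "brownian_motion M B z" and b: "b \<in> Basis" "z \<bullet> b = 0"
  shows "(\<integral>\<omega>. path_inf (tent b) (stopped (ball z 1) (\<lambda>t. B t \<omega>)) \<partial>M) \<noteq> 1"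
proof
  interpret prob_space M using B by (simp add: brownian_motion_def)
  let ?F = "\<lambda>\<omega>. path_inf (tent b) (stopped (ball z 1) (\<lambda>t. B t \<omega>))"
  let ?T = "\<lambda>\<omega>. exit_time (ball z 1) (\<lambda>t. B t \<omega>)"
  assume I: "(\<integral>\<omega>. ?F \<omega> \<partial>M) = 1"
  have F: "0 \<le> ?F \<omega>" "?F \<omega> \<le> 1" for \<omega>
    by (rule path_inf_tent_bounds, simp add: stopped_def exit_time_nonneg)+
  have int: "integrable M ?F" using I not_integrable_integral_eq by fastforce
  have "(\<integral>\<omega>. 1 - ?F \<omega> \<partial>M) = 0" using int I by (simp add: prob_space)
  then have "AE \<omega> in M. 1 - ?F \<omega> = 0"
    by (subst (asm) integral_nonneg_eq_0_iff_AE) (use int F in auto)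
  moreover have "AE \<omega> in M. \<forall>q\<in>\<rat> \<inter> {0<..}. B q \<omega> \<bullet> b \<noteq> z \<bullet> b"
    by (subst AE_ball_countable) (auto intro: brownian_motion_AE_inner_neq[OF B _ b(1)] simp: countable_rat)
  moreover have "AE \<omega> in M. B 0 \<omega> = z" using B by (simp add: brownian_motion_def)
  moreover have "AE \<omega> in M. \<omega> \<in> space M" by (rule AE_space)
  ultimately have "AE \<omega> in M. B 1 \<omega> \<in> ball z 1"
  proof eventually_elim
    fix \<omega> assume \<omega>: "\<omega> \<in> space M"
      and F1: "1 - ?F \<omega> = 0" and q: "\<forall>q\<in>\<rat> \<inter> {0<..}. B q \<omega> \<bullet> b \<noteq> z \<bullet> b" and B0: "B 0 \<omega> = z"
    show "B 1 \<omega> \<in> ball z 1"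
    proof (rule ccontr)
      assume out: "B 1 \<omega> \<notin> ball z 1"
      have cont: "continuous_on {0..} (\<lambda>t. B t \<omega>)" using B \<omega> by (simp add: brownian_motion_def)
      have "\<exists>d>0. \<forall>t\<in>{0..}. dist t 0 < d \<longrightarrow> dist (B t \<omega>) (B 0 \<omega>) < 1"
        using cont[unfolded continuous_on_iff, THEN bspec, of 0, THEN spec, of 1] by simp
      then obtain d where d: "d > 0" "\<And>t. 0 \<le> t \<Longrightarrow> t < d \<Longrightarrow> dist (B t \<omega>) (B 0 \<omega>) < 1"
        by (auto simp: dist_real_def)
      \<comment> \<open>Since the path is outside the ball at time 1, its exit time is a genuine
        infimum and not the default 0; continuity at time 0 makes it positive. This leaves room for
        a rational time before the exit, at which the path is off the line.\<close>
      have "d \<le> ?T \<omega>"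
      proof (rule le_exit_time)
        show "d \<le> t" if "0 \<le> t" "B t \<omega> \<notin> ball z 1" for t
          using that d(2)[of t] B0 by (force simp: dist_commute)
      qed (rule exI[of _ 1], use out in simp)
      moreover obtain s where s: "s \<in> \<rat>" "0 < s" "s < d" using Rats_dense_in_real[OF d(1)] by blast
      ultimately have "?F \<omega> \<le> tent b (B s \<omega>)"
        using path_inf_le[of "tent b" s "stopped (ball z 1) (\<lambda>t. B t \<omega>)", OF tent_nonneg]
        by (simp add: stopped_def)
      then have "B s \<omega> \<bullet> b = 0" using F1 by (auto simp: tent_def split: if_splits)
      then show False using q s b(2) by auto
    qed
  qed
  then show False using brownian_motion_leaves_ball[OF B, of 1 1] by simp
qed

lemma comb_not_converges:
  fixes a :: "'a::euclidean_space"
  assumes a: "a \<in> Basis" and b: "b \<in> Basis" "b \<noteq> a"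
  shows "\<not> srw_converges_to_brownian_motion (comb a) (\<lambda>_. 1)"
proof
  let ?z = "2 *\<^sub>R a" and ?U = "ball (2 *\<^sub>R a) 1"
  let ?x = "\<lambda>\<epsilon>. nearest_vertex (comb a) \<epsilon> ?z"
  assume conv: "srw_converges_to_brownian_motion (comb a) (\<lambda>_. 1)"
  have "bounded_lipschitz_domain ?U \<and> ?z \<in> ?U" using bounded_lipschitz_domain_ball by simp
  from conv[unfolded srw_converges_to_brownian_motion_def, rule_format, OF this]
  obtain M :: "(real \<Rightarrow> 'a) measure" and B where B: "brownian_motion M B ?z"
    and conv: "converges_in_law (\<lambda>\<epsilon>. srw_law (comb a) (\<lambda>_. 1) (?x \<epsilon>))
      (\<lambda>\<epsilon> X. stopped ?U (interpolate (\<lambda>n. \<epsilon> *\<^sub>R X n))) M (\<lambda>\<omega>. stopped ?U (\<lambda>t. B t \<omega>)) (at_right 0)"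
    by blast
  have "bounded (path_inf (tent b) ` curves)"
  proof (rule boundedI[of _ 1])
    fix y assume "y \<in> path_inf (tent b) ` curves"
    then obtain \<gamma> where "0 \<le> fst \<gamma>" "y = path_inf (tent b) \<gamma>" by (auto simp: curves_def)
    then show "norm y \<le> 1" using path_inf_tent_bounds[of \<gamma> b] by simp
  qed
  moreover have "curve_continuous (path_inf (tent b))"
    using tent_lipschitz[OF b(1)] by (intro curve_continuous_path_inf tent_nonneg)
  ultimately have lim: "((\<lambda>\<epsilon>. \<integral>\<omega>. path_inf (tent b) (stopped ?U (interpolate (\<lambda>n. \<epsilon> *\<^sub>R \<omega> n)))
      \<partial>srw_law (comb a) (\<lambda>_. 1) (?x \<epsilon>)) \<longlongrightarrow>
      (\<integral>\<omega>. path_inf (tent b) (stopped ?U (\<lambda>t. B t \<omega>)) \<partial>M)) (at_right 0)" (is "(?f \<longlongrightarrow> ?I) _")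
    using conv unfolding converges_in_law_def by blast
  have pos: "\<forall>\<^sub>F \<epsilon> in at_right 0. (0::real) < \<epsilon>" by (simp add: eventually_at_right_less)
  have "(?f \<longlongrightarrow> 1) (at_right 0)"
  proof (rule tendsto_sandwich)
    \<comment> \<open>The tent equals 1 at \<open>?z\<close> and is 1-Lipschitz, so it loses at most
      the distance from \<open>?z\<close> to the rescaled starting vertex.\<close>
    show "\<forall>\<^sub>F \<epsilon> in at_right (0 :: real). 1 - \<epsilon> * (4 * DIM('a)) \<le> ?f \<epsilon>"
      using pos
    proof eventually_elim
      fix \<epsilon> :: real assume \<epsilon>: "0 < \<epsilon>"
      note x = nearest_vertex_comb[OF \<epsilon>, where a = a and z = ?z]
      have "tent b ?z = 1" using a b by (simp add: tent_def inner_Basis)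
      then show "1 - \<epsilon> * (4 * DIM('a)) \<le> ?f \<epsilon>"
        using tent_lipschitz[OF b(1), of ?z "\<epsilon> *\<^sub>R ?x \<epsilon>"] x(2)
        unfolding integral_srw_comb[OF a b x(1) \<epsilon>] by linarith
    qed
    show "\<forall>\<^sub>F \<epsilon> in at_right (0 :: real). ?f \<epsilon> \<le> 1"
      using pos
      by eventually_elim (simp add: integral_srw_comb[OF a b nearest_vertex_comb(1)] tent_le_1)
    show "((\<lambda>\<epsilon>. 1 - \<epsilon> * (4 * DIM('a))) \<longlongrightarrow> 1) (at_right (0 :: real))"
      by (rule tendsto_eq_intros refl | simp)+
  qed simp
  then have "?I = 1" by (intro tendsto_unique[OF _ lim]) auto
  moreover have "?z \<bullet> b = 0" using a b by (simp add: inner_Basis)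
  ultimately show False using brownian_motion_not_on_line[OF B b(1)] by simp
qed

theorem theorem6p1:
  assumes "CARD('n::finite) \<ge> 3"
  shows "\<exists>(V :: (real ^ 'n) set) r.
     sphere_packing V r \<and> tangency_connected V r \<and> relatively_dense V \<and>
     \<not> srw_converges_to_brownian_motion V r \<and>
     (\<forall>v\<in>V. r v = 1 \<or> r v = 1 / 2) \<and>
     (\<exists>N. \<forall>v\<in>V. finite (neighbors V r v) \<and> card (neighbors V r v) \<le> N)"
proof -
  \<comment> \<open>Two distinct basis vectors are wanted: \<open>a\<close> for the direction of the
    teeth, \<open>b\<close> for the transverse coordinate in which walk and Brownian motion are
    compared.\<close>
  have "\<not> is_singleton (Basis :: (real ^ 'n) set)"
    using assms by (simp add: is_singleton_altdef)
  then obtain a b :: "real ^ 'n" where a: "a \<in> Basis" and b: "b \<in> Basis" "b \<noteq> a"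
    using nonempty_Basis by (metis all_not_in_conv is_singletonI')
  show ?thesis
  proof (intro exI conjI)
    show "sphere_packing (comb a) (\<lambda>_. 1)"
      unfolding sphere_packing_def disjoint_family_on_def
      using comb_dist[of _ a] by (auto intro!: disjoint_ballI[simplified])
    show "tangency_connected (comb a) (\<lambda>_. 1)" by (rule tangency_connected_comb[OF a])
    show "relatively_dense (comb a)" unfolding relatively_dense_def using comb_near by blast
    show "\<not> srw_converges_to_brownian_motion (comb a) (\<lambda>_. 1)" by (rule comb_not_converges[OF a b])
    show "\<forall>v\<in>comb a. finite (neighbors (comb a) (\<lambda>_. 1) v) \<and>
        card (neighbors (comb a) (\<lambda>_. 1) v) \<le> 2 * DIM(real ^ 'n)"
      by (intro ballI finite_neighbors_comb)
  qed simp
qed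

end
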